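(* Let $p\in\{0,1\}$. As formal Laurent series in $x$ with coefficients in $\mathbb{Z}[y,z]$, $$\sum_{n,m,r}w_{[p]}(n,m,r)\,x^ny^mz^r=\frac{1-x^2z^2}{x\Big(1-x-x^2z\big(z+y^{[\![p=1]\!]}\big)+x^3z^2\big(1-y^{[\![p=0]\!]}\big)\Big)}.$$
   Context: $[\![P]\!]$ is the Iverson bracket ($1$ if $P$ is true, $0$ otherwise). An $n$-string is a binary string of length $n$; its Hamming weight is its number of ones. A nonnull run of ones is a maximal block of consecutive ones of length at least $1$; it is a $p$-parity run if its length is congruent to $p$ modulo $2$. For $n\ge 0$, $w_{[p]}(n,m,r)$ is the number of $n$-strings of Hamming weight $r$ containing exactly $m$ nonnull $p$-parity runs of ones. By convention $w_{[p]}(-1,m,r)=1$ if $m=r=0$ and $0$ otherwise, and the quantity is $0$ if $n<-1$, $m<0$ or $r<0$. The sum is over all integers $n,m,r$. *)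

theory Defs
  imports
    "HOL-Computational_Algebra.Computational_Algebra"
    "HOL-Analysis.Analysis"
begin

(* A binary string is a bool list, True being the digit one.  A nonnull run of ones is represented
   by the half-open index interval [i, j) that it occupies. *)

definition hamming_weight :: "bool list \<Rightarrow> nat" where
  "hamming_weight s = count_list s True"

definition one_runs :: "bool list \<Rightarrow> (nat \<times> nat) set" where
  "one_runs s = {(i, j). i < j \<and> j \<le> length s \<and> (\<forall>k\<in>{i..<j}. s ! k) \<and>
     (i = 0 \<or> \<not> s ! (i - 1)) \<and> (j = length s \<or> \<not> s ! j)}"

definition parity_runs :: "nat \<Rightarrow> bool list \<Rightarrow> (nat \<times> nat) set" where
  "parity_runs p s = {(i, j) \<in> one_runs s. (j - i) mod 2 = p mod 2}"

(* For n >= 0 and m < 0 or r < 0 the set of strings below is empty, so the value is 0. *)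
definition w :: "nat \<Rightarrow> int \<Rightarrow> int \<Rightarrow> int \<Rightarrow> nat" where
  "w p n m r =
     (if n \<ge> 0 then card {s. int (length s) = n \<and> int (hamming_weight s) = r \<and>
                           int (card (parity_runs p s)) = m}
      else if n = -1 \<and> m = 0 \<and> r = 0 then 1
      else 0)"

(* Z[y,z] is realised as Z[y][z], i.e. int poly poly; y and z are used as constant Laurent series
   in x, and x is fls_X. *)
type_synonym laurent = "int poly poly fls"

definition var_y :: laurent where
  "var_y = fls_const [:[:0, 1:]:]"

definition var_z :: laurent where
  "var_z = fls_const [:0, 1:]"

(* The term w(n,m,r) x^n y^m z^r.  It vanishes when m < 0 or r < 0, so truncating the exponents of
   y and z by nat is harmless. *)
definition w_term :: "nat \<Rightarrow> int \<times> int \<times> int \<Rightarrow> laurent" where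
  "w_term p = (\<lambda>(n, m, r).
     of_nat (w p n m r) * fls_X_intpow n * var_y ^ nat m * var_z ^ nat r)"

definition w_gf_denominator :: "nat \<Rightarrow> laurent" where
  "w_gf_denominator p =
     fls_X * (1 - fls_X - fls_X ^ 2 * var_z * (var_z + var_y ^ of_bool (p = 1))
                + fls_X ^ 3 * var_z ^ 2 * (1 - var_y ^ of_bool (p = 0)))"

end

theory Submission
  imports Defs
begin

text \<open>
  Append a zero to every string.  The string then factors uniquely into blocks consisting of \<open>k\<close> ones
  and a zero, and such a block contributes \<open>x ^ (k + 1) * z ^ k\<close>, times \<open>y\<close> exactly when \<open>k > 0\<close> and
  \<open>k\<close> has the parity of \<open>p\<close>.  The appended zero shifts the exponent of \<open>x\<close> by one, so the
  conventional term at \<open>n = -1\<close> is the empty product of blocks, and \<open>x\<close> times the generating function is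
  \<open>1 / (1 - B)\<close>, where \<open>B\<close> is the sum over all blocks.  Block weights of the same parity form a geometric
  series of ratio \<open>x\<^sup>2 z\<^sup>2\<close>, which is where the numerator \<open>1 - x\<^sup>2 z\<^sup>2\<close> comes from.

  The formal argument reads the blocks bit by bit.  The state is the number \<open>k\<close> of ones in the
  block being read, and only its parity and whether it is zero matter.  Comparing the states
  \<open>2\<close> and \<open>0\<close> (\<open>scan_enum_2\<close>) therefore closes the system and yields a linear recurrence of order three
  for the coefficients (\<open>coeff_seq_rec\<close>).  In the ring of Laurent series the recurrence says that the
  denominator times the generating function is the numerator (\<open>denominator_times_gf\<close>); multiplying
  by the inverse of the denominator gives the closed form.

  Unconditional convergence is a separate matter (\<open>has_sum_gf\<close>): each coefficient in \<open>x\<close> receives only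
  finitely many nonzero terms, since there are finitely many strings of each length.
\<close>

unbundle no vec_syntax
unbundle Formal_Power_Series.fps_syntax
unbundle Formal_Laurent_Series.fps_syntax

section \<open>Scanning a string from left to right\<close>

text \<open>
  The argument \<open>k\<close> is the length of the run of ones that ends just before the remaining input.
\<close>

fun scan_runs :: "nat \<Rightarrow> nat \<Rightarrow> bool list \<Rightarrow> nat" where
  "scan_runs p k [] = of_bool (0 < k \<and> k mod 2 = p mod 2)"
| "scan_runs p k (True # s) = scan_runs p (Suc k) s"
| "scan_runs p k (False # s) = of_bool (0 < k \<and> k mod 2 = p mod 2) + scan_runs p 0 s"

lemma one_runs_subset: "one_runs s \<subseteq> {..length s} \<times> {..length s}"
  by (auto simp: one_runs_def)

lemma finite_parity_runs: "finite (parity_runs p s)"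
proof (rule finite_subset)
  show "parity_runs p s \<subseteq> {..length s} \<times> {..length s}"
    using one_runs_subset by (auto simp: parity_runs_def)
qed simp

lemma one_runs_replicate_True:
  "one_runs (replicate k True) = (if 0 < k then {(0, k)} else {})"
proof -
  have "i = 0 \<and> j = k" if "(i, j) \<in> one_runs (replicate k True)" for i j
    using that by (auto simp: one_runs_def) (metis le_neq_implies_less nth_replicate)
  moreover have "(0, k) \<in> one_runs (replicate k True)" if "0 < k"
    using that by (auto simp: one_runs_def)
  moreover have "one_runs (replicate 0 True) = {}"
    by (auto simp: one_runs_def)
  ultimately show ?thesis by auto
qed

text \<open>
  A run cannot contain the zero at position \<open>k\<close>, so it lies to its left, where maximality forces it to
  be the whole initial block, or to its right, where it is a translated run of \<open>t\<close>.
\<close>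

lemma one_runs_replicate_True_False:
  "one_runs (replicate k True @ False # t) =
     (if 0 < k then {(0, k)} else {}) \<union> (\<lambda>(i, j). (i + Suc k, j + Suc k)) ` one_runs t"
  (is "one_runs ?s = ?R")
proof (rule subset_antisym; rule subrelI)
  have nth: "?s ! m \<longleftrightarrow> m < k \<or> m > k \<and> t ! (m - Suc k)" if "m < Suc k + length t" for m
    using that by (auto simp: nth_append nth_Cons')
  fix i j
  {
    assume run: "(i, j) \<in> one_runs ?s"
    hence ij: "i < j" "j \<le> Suc k + length t" and ones: "\<And>m. i \<le> m \<Longrightarrow> m < j \<Longrightarrow> ?s ! m"
      and left: "i = 0 \<or> \<not> ?s ! (i - 1)" and right: "j = Suc k + length t \<or> \<not> ?s ! j"
      by (auto simp: one_runs_def)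
    have "\<not> ?s ! k" using nth[of k] by simp
    hence "j \<le> k \<or> k < i" using ones[of k] by linarith
    thus "(i, j) \<in> ?R"
    proof
      assume "j \<le> k"
      hence "i = 0" "j = k" using left right ij nth[of "i - 1"] nth[of j] by auto
      thus ?thesis using ij by auto
    next
      assume "k < i"
      define i' j' where "i' = i - Suc k" and "j' = j - Suc k"
      have eq: "i = i' + Suc k" "j = j' + Suc k"
        using \<open>k < i\<close> ij by (auto simp: i'_def j'_def)
      have "t ! m" if "i' \<le> m" "m < j'" for m
        using ones[of "m + Suc k"] nth[of "m + Suc k"] that ij eq by auto
      moreover have "i' = 0 \<or> \<not> t ! (i' - 1)"
        using left nth[of "i - 1"] ij eq by (cases i') auto
      moreover have "j' = length t \<or> \<not> t ! j'"
        using right nth[of j] ij eq by auto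
      ultimately have "(i', j') \<in> one_runs t"
        using ij eq by (auto simp: one_runs_def)
      thus ?thesis using eq by force
    qed
  }
  {
    assume "(i, j) \<in> ?R"
    then consider "0 < k" "i = 0" "j = k"
      | i' j' where "(i', j') \<in> one_runs t" "i = i' + Suc k" "j = j' + Suc k"
      by (auto split: if_splits)
    thus "(i, j) \<in> one_runs ?s"
    proof cases
      case 1
      thus ?thesis using nth by (auto simp: one_runs_def)
    next
      case 2
      hence run: "i' < j'" "j' \<le> length t" "\<And>m. i' \<le> m \<Longrightarrow> m < j' \<Longrightarrow> t ! m"
        "i' = 0 \<or> \<not> t ! (i' - 1)" "j' = length t \<or> \<not> t ! j'"
        by (auto simp: one_runs_def)
      have "?s ! m" if "i \<le> m" "m < j" for m
        using nth[of m] that 2 run(2) run(3)[of "m - Suc k"] by auto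
      moreover have "\<not> ?s ! (i - 1)"
        using nth[of "i - 1"] 2 run(1,2,4) by (cases i') auto
      moreover have "j = length ?s \<or> \<not> ?s ! j"
        using nth[of j] 2 run(2,5) by auto
      ultimately show ?thesis
        unfolding one_runs_def using 2 run(1,2) by auto
    qed
  }
qed

lemma card_parity_runs_replicate_True:
  "card (parity_runs p (replicate k True)) = of_bool (0 < k \<and> k mod 2 = p mod 2)"
proof -
  have "parity_runs p (replicate k True) =
      (if 0 < k \<and> k mod 2 = p mod 2 then {(0, k)} else {})"
    by (auto simp: parity_runs_def one_runs_replicate_True)
  thus ?thesis by simp
qed

lemma card_parity_runs_replicate_True_False:
  "card (parity_runs p (replicate k True @ False # t)) =
     of_bool (0 < k \<and> k mod 2 = p mod 2) + card (parity_runs p t)"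
proof -
  let ?sh = "\<lambda>(i, j). (i + Suc k, j + Suc k)"
  let ?B = "if 0 < k \<and> k mod 2 = p mod 2 then {(0, k)} else {}"
  have "parity_runs p (replicate k True @ False # t) = ?B \<union> ?sh ` parity_runs p t"
    unfolding parity_runs_def one_runs_replicate_True_False by (auto split: if_splits)
  moreover have "inj_on ?sh (parity_runs p t)"
    by (auto simp: inj_on_def)
  moreover have "?B \<inter> ?sh ` parity_runs p t = {}"
    by auto
  ultimately show ?thesis
    by (simp add: card_Un_disjoint finite_parity_runs card_image)
qed

text \<open>
  Carrying \<open>k\<close> ones is the same as having them in front of the input.  This form is general enough
  for the induction: reading a further one just moves it from \<open>s\<close> to the prefix.
\<close>

lemma card_parity_runs_replicate_append:
  "card (parity_runs p (replicate k True @ s)) = scan_runs p k s"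
proof (induction p k s rule: scan_runs.induct)
  case (2 p k s)
  thus ?case by (simp add: replicate_app_Cons_same)
qed (simp_all add: card_parity_runs_replicate_True card_parity_runs_replicate_True_False)

corollary card_parity_runs: "card (parity_runs p s) = scan_runs p 0 s"
  using card_parity_runs_replicate_append[of p 0 s] by simp

section \<open>The weight enumerators and their recurrence\<close>

definition y_poly :: "int poly poly" where "y_poly = [:[:0, 1:]:]"
definition z_poly :: "int poly poly" where "z_poly = [:0, 1:]"

definition scan_enum :: "nat \<Rightarrow> nat \<Rightarrow> nat \<Rightarrow> int poly poly" where
  "scan_enum p k n =
     (\<Sum>s | length s = n. y_poly ^ scan_runs p k s * z_poly ^ hamming_weight s)"

definition run_weight :: "nat \<Rightarrow> nat \<Rightarrow> int poly poly" where
  "run_weight p k = y_poly ^ of_bool (0 < k \<and> k mod 2 = p mod 2)"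

text \<open>
  The index is shifted so that entry \<open>n\<close> belongs to strings of length \<open>n - 1\<close>; entry \<open>0\<close> is the
  conventional value at length \<open>-1\<close>.
\<close>

definition coeff_seq :: "nat \<Rightarrow> nat \<Rightarrow> int poly poly" where
  "coeff_seq p n = (case n of 0 \<Rightarrow> 1 | Suc n \<Rightarrow> scan_enum p 0 n)"

lemma finite_strings: "finite {s :: bool list. length s = n}"
  using finite_lists_length_eq[of "UNIV :: bool set" n] by simp

lemma scan_enum_0: "scan_enum p k 0 = run_weight p k"
  by (simp add: scan_enum_def run_weight_def hamming_weight_def)

text \<open>
  Split by the first bit: a one prolongs the current run, a zero closes it and collects its weight.
\<close>

lemma scan_enum_Suc:
  "scan_enum p k (Suc n) = z_poly * scan_enum p (Suc k) n + run_weight p k * scan_enum p 0 n"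
proof -
  let ?L = "{s :: bool list. length s = n}"
  let ?f = "\<lambda>s. y_poly ^ scan_runs p k s * z_poly ^ hamming_weight s"
  have L: "{s :: bool list. length s = Suc n} = (#) True ` ?L \<union> (#) False ` ?L"
    by (auto simp: length_Suc_conv image_iff)
  have "scan_enum p k (Suc n) = sum ?f ((#) True ` ?L) + sum ?f ((#) False ` ?L)"
    unfolding scan_enum_def L by (rule sum.union_disjoint) (auto simp: finite_strings)
  also have "sum ?f ((#) True ` ?L) = z_poly * scan_enum p (Suc k) n"
    by (simp add: sum.reindex scan_enum_def sum_distrib_left hamming_weight_def mult_ac)
  also have "sum ?f ((#) False ` ?L) = run_weight p k * scan_enum p 0 n"
    by (simp add: sum.reindex scan_enum_def sum_distrib_left hamming_weight_def run_weight_def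
        power_add mult_ac)
  finally show ?thesis .
qed

lemma scan_enum_add_2:
  assumes "0 < k"
  shows "scan_enum p (k + 2) n = scan_enum p k n"
  using assms
proof (induction n arbitrary: k)
  case 0
  thus ?case by (simp add: scan_enum_0 run_weight_def)
next
  case (Suc n)
  thus ?case
    using Suc.IH[of "Suc k"] by (simp add: scan_enum_Suc run_weight_def)
qed

text \<open>
  A run in progress of length \<open>2\<close> differs from no run at all only when the next bit closes it (or the
  string ends), for after a further one the states are \<open>3\<close> and \<open>1\<close>, which agree by parity.  The
  correction is thus one closing weight times the enumerator of what follows the closing zero.
  When the string ends instead, nothing follows; the value \<open>1\<close> at index \<open>0\<close> of the
  coefficient sequence covers this case.
\<close>

lemma scan_enum_2:
  "scan_enum p 2 n = scan_enum p 0 n + (run_weight p 2 - 1) * coeff_seq p n"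
proof (cases n)
  case 0
  thus ?thesis by (simp add: scan_enum_0 coeff_seq_def run_weight_def)
next
  case (Suc m)
  have "scan_enum p 3 m = scan_enum p 1 m"
    using scan_enum_add_2[of 1 p m] by (simp add: numeral_3_eq_3)
  moreover have "run_weight p 0 = 1"
    by (simp add: run_weight_def)
  ultimately show ?thesis
    by (simp add: Suc scan_enum_Suc coeff_seq_def algebra_simps numeral_3_eq_3 numeral_2_eq_2)
qed

lemma coeff_seq_rec:
  "coeff_seq p (n + 3) = coeff_seq p (n + 2) + z_poly * (z_poly + run_weight p 1) * coeff_seq p (n + 1)
     - z_poly ^ 2 * (1 - run_weight p 2) * coeff_seq p n"
proof -
  have "run_weight p 0 = 1"
    by (simp add: run_weight_def)
  hence "coeff_seq p (n + 3) =
      z_poly * (z_poly * scan_enum p 2 n + run_weight p 1 * scan_enum p 0 n) + scan_enum p 0 (Suc n)"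
    by (simp add: coeff_seq_def scan_enum_Suc numeral_3_eq_3 numeral_2_eq_2)
  thus ?thesis unfolding scan_enum_2
    by (simp add: coeff_seq_def algebra_simps power2_eq_square)
qed

lemma coeff_seq_initial:
  "coeff_seq p 0 = 1" "coeff_seq p 1 = 1" "coeff_seq p 2 = 1 + z_poly * run_weight p 1"
proof -
  have "run_weight p 0 = 1"
    by (simp add: run_weight_def)
  thus "coeff_seq p 0 = 1" "coeff_seq p 1 = 1" "coeff_seq p 2 = 1 + z_poly * run_weight p 1"
    by (simp_all add: coeff_seq_def scan_enum_0 scan_enum_Suc numeral_2_eq_2)
qed

section \<open>The generating function\<close>

definition gf :: "nat \<Rightarrow> laurent" where
  "gf p = fls_shift 1 (fps_to_fls (Abs_fps (coeff_seq p)))"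

lemma fps_coeff_seq_identity:
  fixes p :: nat
  defines "A \<equiv> Abs_fps (coeff_seq p)" and "z \<equiv> fps_const z_poly"
  shows "(1 - fps_X - fps_X ^ 2 * z * (z + fps_const (run_weight p 1))
           + fps_X ^ 3 * z ^ 2 * (1 - fps_const (run_weight p 2))) * A = 1 - fps_X ^ 2 * z ^ 2"
    (is "?E * A = _")
proof (rule fps_ext)
  fix n
  \<comment> \<open>With constant coefficients collected, each summand of the product just shifts the sequence.\<close>
  define c d where "c = z_poly * (z_poly + run_weight p 1)"
    and "d = z_poly ^ 2 * (1 - run_weight p 2)"
  have cd: "fps_const c = z * (z + fps_const (run_weight p 1))"
    "fps_const d = z ^ 2 * (1 - fps_const (run_weight p 2))"
    unfolding c_def d_def z_def fps_const_mult[symmetric] fps_const_add[symmetric]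
      fps_const_sub[symmetric] fps_const_power[symmetric] by simp_all
  have "?E * A = A - fps_X * A - fps_X ^ 2 * (fps_const c * A) + fps_X ^ 3 * (fps_const d * A)"
    unfolding cd by (simp add: algebra_simps)
  hence "(?E * A) $ n = coeff_seq p n - (if n = 0 then 0 else coeff_seq p (n - 1))
      - (if n < 2 then 0 else c * coeff_seq p (n - 2)) + (if n < 3 then 0 else d * coeff_seq p (n - 3))"
    by (simp add: A_def fps_X_power_mult_nth)
  also have "\<dots> = (if n = 0 then 1 else 0) - (if n = 2 then z_poly ^ 2 else 0)"
  proof -
    consider "n = 0" | "n = 1" | "n = 2" | m where "n = m + 3"
    proof -
      have "n = 0 \<or> n = 1 \<or> n = 2 \<or> n = (n - 3) + 3" by arith
      thus thesis using that by blast
    qed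
    thus ?thesis
    proof cases
      case 3
      thus ?thesis using coeff_seq_initial[of p]
        by (simp add: c_def algebra_simps power2_eq_square)
    next
      case 4
      have "m + 3 - 1 = m + 2" "m + 3 - 2 = m + 1" by simp_all
      thus ?thesis using coeff_seq_rec[of p m] unfolding 4
        by (simp add: c_def d_def)
    qed (use coeff_seq_initial[of p] in simp_all)
  qed
  also have "\<dots> = (1 - fps_X ^ 2 * z ^ 2) $ n"
  proof -
    have "(fps_X ^ 2 * z ^ 2) $ n = (if n = 2 then z_poly ^ 2 else 0)"
      unfolding z_def fps_const_power by (simp add: fps_X_power_mult_nth)
    thus ?thesis by simp
  qed
  finally show "(?E * A) $ n = (1 - fps_X ^ 2 * z ^ 2) $ n" .
qed

lemma var_y_eq: "var_y = fps_to_fls (fps_const y_poly)"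
  and var_z_eq: "var_z = fps_to_fls (fps_const z_poly)"
  by (simp_all add: var_y_def var_z_def y_poly_def z_poly_def)

text \<open>
  The exponents of \<open>y\<close> in the denominator are those carried by runs of length \<open>1\<close> and \<open>2\<close>, the shortest
  runs of either parity.
\<close>

lemma denominator_eq:
  assumes "p \<in> {0, 1}"
  shows "w_gf_denominator p = fls_X * fps_to_fls
    (1 - fps_X - fps_X ^ 2 * fps_const z_poly * (fps_const z_poly + fps_const (run_weight p 1))
       + fps_X ^ 3 * fps_const z_poly ^ 2 * (1 - fps_const (run_weight p 2)))"
proof -
  have "var_y ^ of_bool (p = 1) = fps_to_fls (fps_const (run_weight p 1))"
    "var_y ^ of_bool (p = 0) = fps_to_fls (fps_const (run_weight p 2))"
    using assms by (auto simp: run_weight_def var_y_eq)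
  moreover have "(fls_X :: laurent) = fps_to_fls fps_X" by simp
  ultimately show ?thesis
    unfolding w_gf_denominator_def var_z_eq
    by (simp only: fls_times_fps_to_fls fps_to_fls_plus fps_to_fls_minus
        fps_to_fls_power fps_one_to_fls)
qed

lemma denominator_times_gf:
  assumes "p \<in> {0, 1}"
  shows "w_gf_denominator p * gf p = 1 - fls_X ^ 2 * var_z ^ 2"
proof -
  let ?E = "1 - fps_X - fps_X ^ 2 * fps_const z_poly * (fps_const z_poly + fps_const (run_weight p 1))
       + fps_X ^ 3 * fps_const z_poly ^ 2 * (1 - fps_const (run_weight p 2))"
  have "w_gf_denominator p * gf p = fps_to_fls ?E * (fls_X * gf p)"
    unfolding denominator_eq[OF assms] by (simp only: mult_ac)
  also have "fls_X * gf p = fps_to_fls (Abs_fps (coeff_seq p))"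
    by (simp add: gf_def fls_X_times_conv_shift)
  also have "fps_to_fls ?E * \<dots> = fps_to_fls (?E * Abs_fps (coeff_seq p))"
    by (simp only: fls_times_fps_to_fls)
  also have "\<dots> = fps_to_fls (1 - fps_X ^ 2 * fps_const z_poly ^ 2)"
    by (simp only: fps_coeff_seq_identity)
  also have "\<dots> = fps_to_fls 1 - fps_to_fls fps_X ^ 2 * fps_to_fls (fps_const z_poly) ^ 2"
    by (simp only: fls_times_fps_to_fls fps_to_fls_minus fps_to_fls_power)
  finally show ?thesis by (simp add: var_z_eq)
qed

lemma denominator_inverse:
  assumes "p \<in> {0, 1}"
  shows "w_gf_denominator p * fls_right_inverse (w_gf_denominator p) 1 = 1"
proof (rule fls_right_inverse)
  obtain E where E: "w_gf_denominator p = fls_X * fps_to_fls E" "E $ 0 = 1"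
    using denominator_eq[OF assms] by (rule that) (simp add: power2_eq_square power3_eq_cube)
  have nth: "w_gf_denominator p $$ k = (if k < 1 then 0 else E $ nat (k - 1))" for k
    by (simp add: E fls_X_times_conv_shift)
  have "fls_subdegree (w_gf_denominator p) = 1"
    by (rule fls_subdegree_eqI) (simp_all add: nth E(2))
  thus "w_gf_denominator p $$ fls_subdegree (w_gf_denominator p) * 1 = 1"
    by (simp add: nth E(2))
qed

section \<open>Convergence\<close>

text \<open>
  In the \<open>x\<close>-adic metric two series are close once their coefficients agree up to a high index, so it
  suffices that, for each bound \<open>N\<close>, the coefficients up to \<open>N\<close> of the finite partial sums are
  eventually those of \<open>g\<close>.
\<close>

lemma has_sum_flsI:
  fixes f :: "'a \<Rightarrow> 'b :: ab_group_add fls"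
  assumes "\<And>N. \<exists>F. finite F \<and> F \<subseteq> A \<and>
    (\<forall>S i. finite S \<longrightarrow> F \<subseteq> S \<longrightarrow> S \<subseteq> A \<longrightarrow> i \<le> int N \<longrightarrow> (\<Sum>t\<in>S. f t $$ i) = g $$ i)"
  shows "(f has_sum g) A"
  unfolding has_sum_def tendsto_iff
proof (intro allI impI)
  fix e :: real
  assume "e > 0"
  then obtain N where N: "inverse (2 ^ N) < e"
    using reals_power_lt_ex[of e 2] by (auto simp: power_one_over inverse_eq_divide)
  obtain F where F: "finite F" "F \<subseteq> A"
    "\<And>S i. finite S \<Longrightarrow> F \<subseteq> S \<Longrightarrow> S \<subseteq> A \<Longrightarrow> i \<le> int N \<Longrightarrow> (\<Sum>t\<in>S. f t $$ i) = g $$ i"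
    using assms[of N] by blast
  have "dist (sum f S) g < e" if S: "finite S" "F \<subseteq> S" "S \<subseteq> A" for S
  proof (cases "sum f S = g")
    case False
    have "int N < fls_subdegree (sum f S - g)"
      using False F(3)[OF S] by (intro fls_subdegree_greaterI) (simp_all add: fls_nth_sum)
    moreover from this have "N \<le> nat (fls_subdegree (sum f S - g))" by linarith
    hence "inverse (2 ^ nat (fls_subdegree (sum f S - g))) \<le> (inverse (2 ^ N) :: real)"
      by (intro le_imp_inverse_le power_increasing) auto
    ultimately have "dist (sum f S) g \<le> inverse (2 ^ N)" using False by (simp add: dist_fls_def)
    thus ?thesis using N by (rule order.strict_trans1)
  qed (use \<open>e > 0\<close> in simp)
  thus "\<forall>\<^sub>F S in finite_subsets_at_top A. dist (sum f S) g < e"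
    unfolding eventually_finite_subsets_at_top using F(1,2) by blast
qed

lemma w_term_nth:
  "w_term p (n, m, r) $$ i =
     (if i = n then of_nat (w p n m r) * y_poly ^ nat m * z_poly ^ nat r else 0)"
proof -
  have "w_term p (n, m, r) =
      fls_const (of_nat (w p n m r)) * fls_X_intpow n * fls_const (y_poly ^ nat m)
        * fls_const (z_poly ^ nat r)"
    by (simp add: w_term_def var_y_def var_z_def y_poly_def z_poly_def fls_of_nat fls_const_power)
  thus ?thesis
    by (simp del: fls_const_mult_const)
qed

lemma gf_nth: "gf p $$ i = (if i < -1 then 0 else coeff_seq p (nat (i + 1)))"
  by (simp add: gf_def)

definition string_stats :: "nat \<Rightarrow> bool list \<Rightarrow> int \<times> int \<times> int" where
  "string_stats p s = (int (length s), int (card (parity_runs p s)), int (hamming_weight s))"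

text \<open>
  The terms indexed by \<open>t\<close> count the strings with statistics \<open>t\<close>, so summing over all statistics that
  occur is summing over strings, grouped by their statistics.
\<close>

lemma sum_w_term_nth_nat:
  assumes "finite S" and "string_stats p ` {s. length s = n} \<subseteq> S"
  shows "(\<Sum>t\<in>S. w_term p t $$ int n) = scan_enum p 0 n"
proof -
  let ?L = "{s :: bool list. length s = n}"
  let ?f = "\<lambda>s. y_poly ^ scan_runs p 0 s * z_poly ^ hamming_weight s"
  have "w_term p t $$ int n = (\<Sum>s\<in>{s\<in>?L. string_stats p s = t}. ?f s)" for t
  proof -
    obtain n' m r where t: "t = (n', m, r)" by (cases t)
    show ?thesis
    proof (cases "n' = int n")
      case False
      hence no_strings: "{s\<in>?L. string_stats p s = t} = {}" by (auto simp: t string_stats_def)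
      show ?thesis using False unfolding no_strings by (simp add: t w_term_nth)
    next
      case True
      have "{s. int (length s) = n' \<and> int (hamming_weight s) = r \<and>
          int (card (parity_runs p s)) = m} = {s\<in>?L. string_stats p s = t}"
        by (auto simp: t True string_stats_def)
      hence "w p n' m r = card {s\<in>?L. string_stats p s = t}"
        by (simp add: w_def True)
      hence "w_term p t $$ int n =
          (\<Sum>s\<in>{s\<in>?L. string_stats p s = t}. y_poly ^ nat m * z_poly ^ nat r)"
        unfolding t w_term_nth sum_constant by (simp only: True refl if_True mult.assoc)
      also have "\<dots> = (\<Sum>s\<in>{s\<in>?L. string_stats p s = t}. ?f s)"
        by (rule sum.cong) (auto simp: t string_stats_def card_parity_runs)
      finally show ?thesis .
    qed
  qed
  hence "(\<Sum>t\<in>S. w_term p t $$ int n) = (\<Sum>t\<in>S. \<Sum>s\<in>{s\<in>?L. string_stats p s = t}. ?f s)"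
    by simp
  also have "\<dots> = sum ?f ?L"
    using assms by (intro sum.group finite_strings)
  finally show ?thesis unfolding scan_enum_def .
qed

lemma sum_w_term_nth_neg:
  assumes "finite S" and "(-1, 0, 0) \<in> S" and "i < 0"
  shows "(\<Sum>t\<in>S. w_term p t $$ i) = (if i = -1 then 1 else 0)"
proof -
  have "w_term p t $$ i = (if t = (-1, 0, 0) then (if i = -1 then 1 else 0) else 0)" for t
    using \<open>i < 0\<close> by (cases t) (auto simp: w_term_nth w_def)
  thus ?thesis using assms(1,2) by simp
qed

lemma has_sum_gf: "(w_term p has_sum gf p) UNIV"
proof (rule has_sum_flsI)
  fix N :: nat
  \<comment> \<open>The index \<open>(-1, 0, 0)\<close> comes from no string and must be added for the conventional term.\<close>
  let ?F = "insert (-1, 0, 0) (string_stats p ` (\<Union>n\<le>N. {s. length s = n}))"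
  have "(\<Sum>t\<in>S. w_term p t $$ i) = gf p $$ i"
    if S: "finite S" "?F \<subseteq> S" and i: "i \<le> int N" for S i
  proof (cases "i < 0")
    case True
    thus ?thesis using sum_w_term_nth_neg[OF S(1) _ True, of p] S(2)
      by (simp add: gf_nth coeff_seq_initial)
  next
    case False
    then obtain n where n: "i = int n" by (metis nat_0_le not_less)
    hence "string_stats p ` {s. length s = n} \<subseteq> S" using S(2) i by auto
    from sum_w_term_nth_nat[OF S(1) this] show ?thesis
      by (simp add: n gf_nth coeff_seq_def nat_add_distrib)
  qed
  moreover have "finite ?F"
    by (auto simp: finite_strings)
  ultimately show "\<exists>F. finite F \<and> F \<subseteq> UNIV \<and> (\<forall>S i. finite S \<longrightarrow> F \<subseteq> S \<longrightarrow> S \<subseteq> UNIV \<longrightarrow>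
      i \<le> int N \<longrightarrow> (\<Sum>t\<in>S. w_term p t $$ i) = gf p $$ i)"
    by (intro exI[of _ ?F] conjI allI impI subset_UNIV)
qed

(* Summation is with respect to the x-adic metric carried by the type of formal Laurent series.
   Z[y,z] is not a field, so the fraction is the numerator times the inverse of the denominator,
   whose leading coefficient is 1; the first conjunct says that this is a genuine inverse. *)
theorem mainTheorem14:
  fixes p :: nat
  assumes "p \<in> {0, 1}"
  shows "w_gf_denominator p * fls_right_inverse (w_gf_denominator p) 1 = 1 \<and>
    (w_term p has_sum
      ((1 - fls_X ^ 2 * var_z ^ 2) * fls_right_inverse (w_gf_denominator p) 1)) UNIV"
proof -
  let ?D = "w_gf_denominator p"
  have inv: "?D * fls_right_inverse ?D 1 = 1"
    using assms by (rule denominator_inverse)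
  have "gf p = gf p * (?D * fls_right_inverse ?D 1)"
    by (simp only: inv mult_1_right)
  also have "\<dots> = (?D * gf p) * fls_right_inverse ?D 1"
    by (simp only: mult_ac)
  finally have "gf p = (1 - fls_X ^ 2 * var_z ^ 2) * fls_right_inverse ?D 1"
    unfolding denominator_times_gf[OF assms] .
  thus ?thesis using inv has_sum_gf[of p] by simp
qed

end
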